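(* Let $n\ge 4$ and let $\Sigma_{n,\sigma}=(K_n,\sigma)$ be a signed complete graph on $n$ vertices. Then the following hold. (a) All Hamiltonian cycles of $\Sigma_{n,\sigma}$ are negative if and only if all triangles of $\Sigma_{n,\sigma}$ are negative and $n$ is odd. All Hamiltonian cycles of $\Sigma_{n,\sigma}$ are positive if and only if either all triangles are negative and $n$ is even, or all triangles are positive. (b) $\Sigma_{n,\sigma}$ contains both a positive Hamiltonian cycle and a negative Hamiltonian cycle if and only if it contains at least one positive triangle and at least one negative triangle.
   Context: A signed complete graph $(K_n,\sigma)$ consists of the complete graph $K_n$ on $n$ vertices together with a function $\sigma$ assigning to each (undirected) edge of $K_n$ a sign, $+1$ or $-1$. The sign of a cycle is the product of the signs of its edges; a cycle is positive if its sign is $+1$ and negative if its sign is $-1$. A triangle is a cycle of length 3. A Hamiltonian cycle is a cycle passing through every vertex exactly once. *)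

theory Defs
  imports Main
begin

definition complete_edges :: "'a set \<Rightarrow> 'a set set" where
  "complete_edges V = {e. e \<subseteq> V \<and> card e = 2}"

(* The signature is only constrained on the edges of the complete graph on V;
   its values on other sets are irrelevant. *)
definition signed_complete_graph :: "nat \<Rightarrow> 'a set \<Rightarrow> ('a set \<Rightarrow> int) \<Rightarrow> bool" where
  "signed_complete_graph n V \<sigma> \<longleftrightarrow>
     finite V \<and> card V = n \<and> (\<forall>e \<in> complete_edges V. \<sigma> e = 1 \<or> \<sigma> e = -1)"

(* A cycle is given by the list of its vertices in cyclic order, without repeating
   the starting vertex, so each cycle is represented by all rotations and reversals
   of such a list; all of these have the same set of edges. *)
definition cycle_edges :: "'a list \<Rightarrow> 'a set set" where
  "cycle_edges vs = {{vs ! i, vs ! (Suc i mod length vs)} | i. i < length vs}"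

definition is_cycle :: "'a set \<Rightarrow> 'a list \<Rightarrow> bool" where
  "is_cycle V vs \<longleftrightarrow>
     3 \<le> length vs \<and> distinct vs \<and> set vs \<subseteq> V \<and> cycle_edges vs \<subseteq> complete_edges V"

definition triangle :: "'a set \<Rightarrow> 'a list \<Rightarrow> bool" where
  "triangle V vs \<longleftrightarrow> is_cycle V vs \<and> length vs = 3"

definition hamiltonian_cycle :: "'a set \<Rightarrow> 'a list \<Rightarrow> bool" where
  "hamiltonian_cycle V vs \<longleftrightarrow> is_cycle V vs \<and> set vs = V"

definition cycle_sign :: "('a set \<Rightarrow> int) \<Rightarrow> 'a list \<Rightarrow> int" where
  "cycle_sign \<sigma> vs = (\<Prod>e \<in> cycle_edges vs. \<sigma> e)"

definition positive_cycle :: "('a set \<Rightarrow> int) \<Rightarrow> 'a list \<Rightarrow> bool" where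
  "positive_cycle \<sigma> vs \<longleftrightarrow> cycle_sign \<sigma> vs = 1"

definition negative_cycle :: "('a set \<Rightarrow> int) \<Rightarrow> 'a list \<Rightarrow> bool" where
  "negative_cycle \<sigma> vs \<longleftrightarrow> cycle_sign \<sigma> vs = -1"

end

theory Submission imports Defs begin

text \<open>
  Write \<open>\<sigma> u v\<close> for the sign of the edge \<open>{u, v}\<close>. The theorem rests on the equivalence of

    (i) all triangles have one common sign, and (ii) all Hamiltonian cycles have one common sign,

  together with the value of the second sign in terms of the first.

  From (i) to (ii): a chord splits a cycle of length \<open>k > 3\<close> into a triangle and a cycle of length
  \<open>k - 1\<close>, and the chord's sign cancels because it is counted twice. So if every triangle has sign
  \<open>\<epsilon>\<close>, a cycle of length \<open>k\<close> has sign \<open>\<epsilon> ^ (k - 2) = \<epsilon> ^ k\<close>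
  (\<open>cycle_sign_of_uniform_triangles\<close>).

  From (ii) to (i): exchanging two consecutive vertices \<open>b, c\<close> in a Hamiltonian cycle
  \<open>a, b, c, d, \<dots>\<close> replaces only the edges \<open>a b\<close> and \<open>c d\<close> by \<open>a c\<close> and \<open>b d\<close>. If the sign is
  unchanged, the product of these four edge signs is \<open>1\<close>; but it is also the product of the signs
  of the triangles \<open>a b c\<close> and \<open>d b c\<close>. Hence triangles that share an edge have the same sign, and
  replacing one vertex at a time connects any two triangles
  (\<open>uniform_triangles_of_uniform_hamiltonian\<close>).

  Part (b) is the negation of the equivalence. For part (a), the common triangle sign \<open>\<epsilon>\<close> satisfies
  \<open>\<epsilon> ^ n = -1\<close> exactly if \<open>\<epsilon> = -1\<close> and \<open>n\<close> is odd.
\<close>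

section \<open>The sign of a cycle as a product along a closed walk\<close>

text \<open>Unlike the product over the edge set, the product along a vertex list counts repeated edges
  and can be computed by recursion.\<close>

fun walk_sign :: "('a set \<Rightarrow> int) \<Rightarrow> 'a list \<Rightarrow> int" where
  "walk_sign \<sigma> (x # y # zs) = \<sigma> {x, y} * walk_sign \<sigma> (y # zs)"
| "walk_sign \<sigma> _ = 1"

lemma walk_sign_eq_prod:
  "walk_sign \<sigma> xs = (\<Prod>i<length xs - 1. \<sigma> {xs ! i, xs ! Suc i})"
proof (induction \<sigma> xs rule: walk_sign.induct)
  case (1 \<sigma> x y zs)
  then show ?case
    by (simp add: prod.lessThan_Suc_shift del: prod.lessThan_Suc)
qed simp_all

text \<open>Length at least 3 matters here: on two vertices both steps use the same edge.\<close>

lemma inj_on_cycle_edge: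
  assumes "distinct vs" and "3 \<le> length vs"
  shows "inj_on (\<lambda>i. {vs ! i, vs ! (Suc i mod length vs)}) {..<length vs}"
proof (rule inj_onI)
  fix i j
  assume ij: "i \<in> {..<length vs}" "j \<in> {..<length vs}"
    and eq: "{vs ! i, vs ! (Suc i mod length vs)} = {vs ! j, vs ! (Suc j mod length vs)}"
  have "Suc i mod length vs < length vs" "Suc j mod length vs < length vs"
    using assms by (auto intro!: mod_less_divisor)
  with ij eq have "i = j \<or> (i = Suc j mod length vs \<and> Suc i mod length vs = j)"
    by (auto simp: doubleton_eq_iff nth_eq_iff_index_eq[OF assms(1)])
  moreover have "\<not> (i = Suc j mod length vs \<and> Suc i mod length vs = j)"
    using ij assms(2) by (auto simp: mod_Suc split: if_splits)
  ultimately show "i = j" by blast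
qed

lemma cycle_sign_eq_walk_sign:
  assumes "distinct vs" and "3 \<le> length vs"
  shows "cycle_sign \<sigma> vs = walk_sign \<sigma> (vs @ [hd vs])"
proof -
  have "cycle_edges vs = (\<lambda>i. {vs ! i, vs ! (Suc i mod length vs)}) ` {..<length vs}"
    by (auto simp: cycle_edges_def)
  then have "cycle_sign \<sigma> vs = (\<Prod>i<length vs. \<sigma> {vs ! i, vs ! (Suc i mod length vs)})"
    by (simp add: cycle_sign_def prod.reindex[OF inj_on_cycle_edge[OF assms]])
  also have "\<dots> = (\<Prod>i<length vs. \<sigma> {(vs @ [hd vs]) ! i, (vs @ [hd vs]) ! Suc i})"
  proof (rule prod.cong)
    fix i assume "i \<in> {..<length vs}"
    moreover have "hd vs = vs ! 0"
      using assms(2) by (intro hd_conv_nth) auto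
    ultimately show "\<sigma> {vs ! i, vs ! (Suc i mod length vs)} =
        \<sigma> {(vs @ [hd vs]) ! i, (vs @ [hd vs]) ! Suc i}"
      by (auto simp: nth_append mod_Suc)
  qed simp
  finally show ?thesis by (simp add: walk_sign_eq_prod)
qed

lemma is_cycle_iff:
  "is_cycle V vs \<longleftrightarrow> 3 \<le> length vs \<and> distinct vs \<and> set vs \<subseteq> V"
proof -
  have "cycle_edges vs \<subseteq> complete_edges V"
    if len: "3 \<le> length vs" and dist: "distinct vs" and sub: "set vs \<subseteq> V"
  proof
    fix e assume "e \<in> cycle_edges vs"
    then obtain i where i: "i < length vs" and e: "e = {vs ! i, vs ! (Suc i mod length vs)}"
      by (auto simp: cycle_edges_def)
    have j: "Suc i mod length vs < length vs"
      using i by (auto intro!: mod_less_divisor)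
    have "i \<noteq> Suc i mod length vs"
      using i len by (auto simp: mod_Suc)
    then have "vs ! i \<noteq> vs ! (Suc i mod length vs)"
      using i j dist by (simp add: nth_eq_iff_index_eq)
    moreover have "vs ! i \<in> V" "vs ! (Suc i mod length vs) \<in> V"
      using i j sub nth_mem by blast+
    ultimately show "e \<in> complete_edges V"
      by (simp add: e complete_edges_def)
  qed
  then show ?thesis by (auto simp: is_cycle_def)
qed

lemma triangle_iff:
  "triangle V t \<longleftrightarrow> (\<exists>a b c. t = [a, b, c] \<and> distinct [a, b, c] \<and> {a, b, c} \<subseteq> V)"
  by (auto simp: triangle_def is_cycle_iff length_Suc_conv numeral_3_eq_3)

lemma cycle_sign_triangle:
  assumes "distinct [a, b, c]"
  shows "cycle_sign \<sigma> [a, b, c] = \<sigma> {a, b} * \<sigma> {b, c} * \<sigma> {c, a}"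
  using assms by (simp add: cycle_sign_eq_walk_sign del: distinct.simps)

lemma signed_edge:
  assumes "signed_complete_graph n V \<sigma>" and "u \<in> V" and "v \<in> V" and "u \<noteq> v"
  shows "\<sigma> {u, v} = 1 \<or> \<sigma> {u, v} = -1"
  using assms by (auto simp: signed_complete_graph_def complete_edges_def)

lemma cycle_sign_cases:
  assumes "signed_complete_graph n V \<sigma>" and "is_cycle V vs"
  shows "cycle_sign \<sigma> vs = 1 \<or> cycle_sign \<sigma> vs = -1"
proof -
  have "\<forall>e\<in>cycle_edges vs. \<sigma> e = 1 \<or> \<sigma> e = -1"
    using assms by (auto simp: is_cycle_def signed_complete_graph_def)
  moreover have "prod \<sigma> E \<in> {1, -1}" if "\<forall>e\<in>E. \<sigma> e = 1 \<or> \<sigma> e = -1" for E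
    using that by (induction E rule: infinite_finite_induct) auto
  ultimately have "prod \<sigma> (cycle_edges vs) \<in> {1, -1}" by blast
  then show ?thesis by (simp add: cycle_sign_def)
qed

section \<open>Triangles determine all cycles\<close>

text \<open>The chord from the first to the third vertex cuts off a triangle. The remaining cycle starts
  at the same vertex \<open>a\<close>, so the induction on \<open>r\<close> keeps \<open>a\<close> fixed and generalizes the next two
  vertices.\<close>

lemma cycle_sign_of_uniform_triangles:
  assumes G: "signed_complete_graph n V \<sigma>"
    and tri: "\<And>t. triangle V t \<Longrightarrow> cycle_sign \<sigma> t = \<epsilon>"
    and cyc: "is_cycle V vs"
  shows "cycle_sign \<sigma> vs = \<epsilon> ^ length vs"
proof -
  have abc: "\<sigma> {a, b} * \<sigma> {b, c} * \<sigma> {c, a} = \<epsilon>"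
    if "distinct [a, b, c]" "{a, b, c} \<subseteq> V" for a b c
    using tri[of "[a, b, c]"] that cycle_sign_triangle[OF that(1), of \<sigma>]
    by (auto simp: triangle_iff)
  obtain a b c r where vs: "vs = a # b # c # r"
    using cyc by (auto simp: is_cycle_iff Suc_le_length_iff numeral_3_eq_3)
  have "walk_sign \<sigma> (a # b # c # r @ [a]) = \<epsilon> ^ length (a # b # c # r)"
    if "distinct (a # b # c # r)" "set (a # b # c # r) \<subseteq> V" for b c
    using that
  proof (induction r arbitrary: b c)
    case Nil
    have "cycle_sign \<sigma> [a, b, c] = 1 \<or> cycle_sign \<sigma> [a, b, c] = -1"
      using cycle_sign_cases[OF G] Nil by (auto simp: is_cycle_iff)
    moreover have "cycle_sign \<sigma> [a, b, c] = \<epsilon>"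
      using tri Nil by (auto simp: triangle_iff)
    \<comment> \<open>The edge signs multiply to \<open>\<epsilon>\<close>, which equals the claimed \<open>\<epsilon> ^ 3\<close> because \<open>\<epsilon>\<close> is a sign.\<close>
    ultimately have "\<epsilon> * (\<epsilon> * \<epsilon>) = \<epsilon>" by auto
    then show ?case using abc[of a b c] Nil by (simp add: mult.assoc)
  next
    case (Cons d r)
    have "\<sigma> {a, c} * \<sigma> {a, c} = 1"
      using signed_edge[OF G, of a c] Cons.prems by auto
    moreover have "\<sigma> {a, b} * \<sigma> {b, c} * \<sigma> {a, c} = \<epsilon>"
      using abc[of a b c] Cons.prems by (auto simp: insert_commute)
    ultimately have "\<sigma> {a, b} * \<sigma> {b, c} = \<epsilon> * \<sigma> {a, c}"
      by (metis mult.assoc mult.right_neutral)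
    moreover have "walk_sign \<sigma> (a # c # d # r @ [a]) = \<epsilon> ^ length (a # c # d # r)"
      using Cons.IH[of c d] Cons.prems by auto
    ultimately have "walk_sign \<sigma> (a # b # c # (d # r) @ [a]) = \<epsilon> * \<epsilon> ^ length (a # c # d # r)"
      by (simp flip: mult.assoc)
    then show ?case by simp
  qed
  from this[of b c] show ?thesis
    using cyc by (simp add: vs is_cycle_iff cycle_sign_eq_walk_sign)
qed

section \<open>Hamiltonian cycles determine all triangles\<close>

text \<open>The two Hamiltonian cycles \<open>a b c d r\<close> and \<open>a c b d r\<close> share all but two edges of each. The rest \<open>r\<close> may
  be empty, so the common part is taken as the walk from \<open>d\<close> back to \<open>a\<close>.\<close>

lemma exchange_of_uniform_hamiltonian:
  assumes G: "signed_complete_graph n V \<sigma>"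
    and ham: "\<And>c. hamiltonian_cycle V c \<Longrightarrow> cycle_sign \<sigma> c = \<delta>"
    and dist: "distinct [a, b, c, d]" and sub: "{a, b, c, d} \<subseteq> V"
  shows "cycle_sign \<sigma> [a, b, c] = cycle_sign \<sigma> [d, b, c]"
proof -
  have "finite (V - {a, b, c, d})"
    using G by (simp add: signed_complete_graph_def)
  from finite_distinct_list[OF this] obtain r where r: "set r = V - {a, b, c, d}" "distinct r"
    by (elim exE conjE)
  let ?w = "walk_sign \<sigma> (d # r @ [a])"
  have edge: "\<sigma> {u, v} = 1 \<or> \<sigma> {u, v} = -1"
    if "u \<in> {a, b, c, d}" "v \<in> {a, b, c, d}" "u \<noteq> v" for u v
    using signed_edge[OF G] that sub by blast
  have "hamiltonian_cycle V (a # b # c # d # r)" "hamiltonian_cycle V (a # c # b # d # r)"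
    using r dist sub by (auto simp: hamiltonian_cycle_def is_cycle_iff)
  then have eq: "cycle_sign \<sigma> (a # b # c # d # r) = cycle_sign \<sigma> (a # c # b # d # r)"
    and nz: "cycle_sign \<sigma> (a # b # c # d # r) \<noteq> 0"
    using ham cycle_sign_cases[OF G] by (fastforce simp: hamiltonian_cycle_def)+
  have "distinct (a # b # c # d # r)" "distinct (a # c # b # d # r)"
    using r dist by auto
  then have "cycle_sign \<sigma> (a # b # c # d # r) = \<sigma> {a, b} * \<sigma> {b, c} * \<sigma> {c, d} * ?w"
    and "cycle_sign \<sigma> (a # c # b # d # r) = \<sigma> {a, c} * \<sigma> {b, c} * \<sigma> {b, d} * ?w"
    by (simp_all add: cycle_sign_eq_walk_sign insert_commute mult.assoc del: distinct.simps)
  with eq nz have "\<sigma> {a, b} * \<sigma> {c, d} = \<sigma> {a, c} * \<sigma> {b, d}"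
    by auto
  moreover have "\<sigma> {a, b} = 1 \<or> \<sigma> {a, b} = -1" "\<sigma> {c, d} = 1 \<or> \<sigma> {c, d} = -1"
    "\<sigma> {a, c} = 1 \<or> \<sigma> {a, c} = -1" "\<sigma> {b, d} = 1 \<or> \<sigma> {b, d} = -1"
    using dist by (intro edge; simp)+
  ultimately have "\<sigma> {a, b} * \<sigma> {a, c} = \<sigma> {b, d} * \<sigma> {c, d}"
    by auto
  moreover have "distinct [a, b, c]" "distinct [d, b, c]"
    using dist by auto
  ultimately show ?thesis
    by (simp add: cycle_sign_triangle del: distinct.simps) (simp add: insert_commute mult.commute mult.left_commute)
qed

text \<open>Passing from one triangle to another through triangles that share an edge: first bring a
  fixed vertex \<open>x\<close> into the triangle, then exchange the other two vertices.\<close>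

lemma uniform_triangles_of_uniform_hamiltonian:
  assumes G: "signed_complete_graph n V \<sigma>"
    and ham: "\<And>c. hamiltonian_cycle V c \<Longrightarrow> cycle_sign \<sigma> c = \<delta>"
    and t: "triangle V t" and t': "triangle V t'"
  shows "cycle_sign \<sigma> t = cycle_sign \<sigma> t'"
proof -
  define T where "T a b c = \<sigma> {a, b} * \<sigma> {b, c} * \<sigma> {c, a}" for a b c
  have rot: "T a b c = T b c a" and refl: "T a b c = T a c b" for a b c
    by (simp_all add: T_def insert_commute mult.commute mult.left_commute)
  have swap: "T a b c = T d b c"
    if "distinct [a, b, c]" "distinct [d, b, c]" "{a, b, c, d} \<subseteq> V" for a b c d
  proof (cases "a = d")
    case False
    with that have "distinct [a, b, c, d]" by auto
    from exchange_of_uniform_hamiltonian[OF G ham this that(3)] show ?thesis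
      using cycle_sign_triangle[OF that(1), of \<sigma>] cycle_sign_triangle[OF that(2), of \<sigma>]
      by (simp only: T_def)
  qed simp
  obtain x y z where t_eq: "t = [x, y, z]" and xyz: "distinct [x, y, z]" "{x, y, z} \<subseteq> V"
    using t by (auto simp: triangle_iff)
  obtain a b c where t'_eq: "t' = [a, b, c]" and abc: "distinct [a, b, c]" "{a, b, c} \<subseteq> V"
    using t' by (auto simp: triangle_iff)
  have "\<exists>p q. distinct [x, p, q] \<and> {p, q} \<subseteq> V \<and> T a b c = T x p q"
  proof -
    consider "x = b" | "x = c" | "x \<noteq> b" "x \<noteq> c" by blast
    then show ?thesis
    proof cases
      case 1
      then show ?thesis using abc rot[of a b c] by (intro exI[of _ c] exI[of _ a]) auto
    next
      case 2
      then show ?thesis using abc rot[of c a b] by (intro exI[of _ a] exI[of _ b]) auto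
    next
      case 3
      then show ?thesis using abc xyz swap[of a b c x] by (intro exI[of _ b] exI[of _ c]) auto
    qed
  qed
  then obtain p q where pq: "distinct [x, p, q]" "{p, q} \<subseteq> V" and T: "T a b c = T x p q"
    by blast
  have swap_last: "T x u v = T x u w"
    if "distinct [x, u, v]" "distinct [x, u, w]" "{u, v, w} \<subseteq> V" for u v w
    using swap[of v x u w] that xyz rot[of v x u] rot[of w x u] by auto
  have "T x p q = T x y z"
  proof (cases "y = q")
    case True
    then show ?thesis using swap_last[of y p z] refl[of x p y] pq xyz by auto
  next
    case False
    have "T x p q = T x q y"
      using swap_last[of q p y] refl[of x p q] False pq xyz by auto
    also have "\<dots> = T x y z"
      using swap_last[of y q z] refl[of x q y] False pq xyz by auto
    finally show ?thesis .
  qed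
  with T show ?thesis
    using xyz(1) abc(1) by (simp add: t_eq t'_eq T_def cycle_sign_triangle del: distinct.simps)
qed

section \<open>Signs of Hamiltonian cycles and triangles\<close>

theorem theorem5p1:
  fixes n :: nat and V :: "'a set" and \<sigma> :: "'a set \<Rightarrow> int"
  assumes "n \<ge> 4" and "signed_complete_graph n V \<sigma>"
  shows
    "(((\<forall>c. hamiltonian_cycle V c \<longrightarrow> negative_cycle \<sigma> c) \<longleftrightarrow>
        (\<forall>t. triangle V t \<longrightarrow> negative_cycle \<sigma> t) \<and> odd n)
      \<and> ((\<forall>c. hamiltonian_cycle V c \<longrightarrow> positive_cycle \<sigma> c) \<longleftrightarrow>
        ((\<forall>t. triangle V t \<longrightarrow> negative_cycle \<sigma> t) \<and> even n)
          \<or> (\<forall>t. triangle V t \<longrightarrow> positive_cycle \<sigma> t)))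
     \<and> ((\<exists>c. hamiltonian_cycle V c \<and> positive_cycle \<sigma> c) \<and>
        (\<exists>c. hamiltonian_cycle V c \<and> negative_cycle \<sigma> c)
        \<longleftrightarrow>
        (\<exists>t. triangle V t \<and> positive_cycle \<sigma> t) \<and>
        (\<exists>t. triangle V t \<and> negative_cycle \<sigma> t))"
proof -
  note G = assms(2)
  have fin: "finite V" and card: "card V = n"
    using G by (auto simp: signed_complete_graph_def)
  \<comment> \<open>Without a triangle and a Hamiltonian cycle the universal statements would hold vacuously.\<close>
  obtain h where h: "set h = V" "distinct h"
    using finite_distinct_list[OF fin] by blast
  then have len: "length h = n"
    using card distinct_card by fastforce
  then have ham: "hamiltonian_cycle V h"
    using h assms(1) by (simp add: hamiltonian_cycle_def is_cycle_iff)
  have "triangle V (take 3 h)"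
    using h len assms(1) set_take_subset[of 3 h] by (auto simp: triangle_def is_cycle_iff)
  then obtain t0 where t0: "triangle V t0" ..
  have sign_ham: "cycle_sign \<sigma> c = 1 \<or> cycle_sign \<sigma> c = -1" if "hamiltonian_cycle V c" for c
    using cycle_sign_cases[OF G] that by (simp add: hamiltonian_cycle_def)
  have sign_tri: "cycle_sign \<sigma> t = 1 \<or> cycle_sign \<sigma> t = -1" if "triangle V t" for t
    using cycle_sign_cases[OF G] that by (simp add: triangle_def)
  have up: "cycle_sign \<sigma> c = \<epsilon> ^ n"
    if "\<forall>t. triangle V t \<longrightarrow> cycle_sign \<sigma> t = \<epsilon>" "hamiltonian_cycle V c" for c \<epsilon>
  proof -
    have "is_cycle V c" "length c = n"
      using that(2) card by (auto simp: hamiltonian_cycle_def is_cycle_iff distinct_card)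
    then show ?thesis
      using cycle_sign_of_uniform_triangles[OF G, of \<epsilon> c] that(1) by blast
  qed
  have down: "(\<forall>t. triangle V t \<longrightarrow> cycle_sign \<sigma> t = 1) \<or> (\<forall>t. triangle V t \<longrightarrow> cycle_sign \<sigma> t = -1)"
    if ham: "\<forall>c. hamiltonian_cycle V c \<longrightarrow> cycle_sign \<sigma> c = \<delta>" for \<delta>
  proof -
    have "cycle_sign \<sigma> t = cycle_sign \<sigma> t0" if "triangle V t" for t
      by (rule uniform_triangles_of_uniform_hamiltonian[OF G _ that t0]) (simp add: ham)
    then show ?thesis using sign_tri[OF t0] by auto
  qed
  have up_pos: "\<forall>c. hamiltonian_cycle V c \<longrightarrow> cycle_sign \<sigma> c = 1"
    if "\<forall>t. triangle V t \<longrightarrow> cycle_sign \<sigma> t = 1"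
    using up[OF that] by simp
  have up_even: "\<forall>c. hamiltonian_cycle V c \<longrightarrow> cycle_sign \<sigma> c = 1"
    if "\<forall>t. triangle V t \<longrightarrow> cycle_sign \<sigma> t = -1" "even n"
    using up[OF that(1)] that(2) by simp
  have up_odd: "\<forall>c. hamiltonian_cycle V c \<longrightarrow> cycle_sign \<sigma> c = -1"
    if "\<forall>t. triangle V t \<longrightarrow> cycle_sign \<sigma> t = -1" "odd n"
    using up[OF that(1)] that(2) by simp
  \<comment> \<open>As every sign is \<open>1\<close> or \<open>-1\<close>, both parts are propositional statements about these four.\<close>
  define HP HN TP TN where
    "HP \<longleftrightarrow> (\<forall>c. hamiltonian_cycle V c \<longrightarrow> cycle_sign \<sigma> c = 1)" and
    "HN \<longleftrightarrow> (\<forall>c. hamiltonian_cycle V c \<longrightarrow> cycle_sign \<sigma> c = -1)" and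
    "TP \<longleftrightarrow> (\<forall>t. triangle V t \<longrightarrow> cycle_sign \<sigma> t = 1)" and
    "TN \<longleftrightarrow> (\<forall>t. triangle V t \<longrightarrow> cycle_sign \<sigma> t = -1)"
  note defs = HP_def HN_def TP_def TN_def
  have excl: "\<not> (HP \<and> HN)"
    unfolding defs using ham by fastforce
  have neg_iff: "x = -1 \<longleftrightarrow> \<not> x = 1" if "x = 1 \<or> x = -1" for x :: int
    using that by auto
  have ex_ham: "(\<exists>c. hamiltonian_cycle V c \<and> cycle_sign \<sigma> c = 1) \<longleftrightarrow> \<not> HN"
    "(\<exists>c. hamiltonian_cycle V c \<and> cycle_sign \<sigma> c = -1) \<longleftrightarrow> \<not> HP"
    unfolding defs using neg_iff[OF sign_ham] by blast+
  have ex_tri: "(\<exists>t. triangle V t \<and> cycle_sign \<sigma> t = 1) \<longleftrightarrow> \<not> TN"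
    "(\<exists>t. triangle V t \<and> cycle_sign \<sigma> t = -1) \<longleftrightarrow> \<not> TP"
    unfolding defs using neg_iff[OF sign_tri] by blast+
  have "HP \<longrightarrow> TP \<or> TN" "HN \<longrightarrow> TP \<or> TN" "TP \<longrightarrow> HP" "TN \<and> even n \<longrightarrow> HP" "TN \<and> odd n \<longrightarrow> HN"
    unfolding defs using down[of 1] down[of "-1"] up_pos up_even up_odd by blast+
  with excl have
    "((HN \<longleftrightarrow> TN \<and> odd n) \<and> (HP \<longleftrightarrow> TN \<and> even n \<or> TP)) \<and> (\<not> HN \<and> \<not> HP \<longleftrightarrow> \<not> TN \<and> \<not> TP)"
    by blast
  then show ?thesis
    unfolding positive_cycle_def negative_cycle_def ex_ham ex_tri
    unfolding defs[symmetric] .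
qed

end
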